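(* For any Hom-Lie algebra $(L,\alpha_L)$ over $\mathbb F$ with surjective endomorphism $\alpha_L$, $$Z^{\star}_{\alpha}(L)=Z^{\curlywedge}_{\alpha}(L)\cap[L,L].$$
   Context: Fix a field $\mathbb F$. A (multiplicative) Hom-Lie algebra $(L,\alpha_L)$ is an $\mathbb F$-vector space $L$ with a bilinear product $[\,,]$ and a linear map $\alpha_L:L\to L$ such that $[x,y]=-[y,x]$, $[\alpha_L(x),[y,z]]+[\alpha_L(y),[z,x]]+[\alpha_L(z),[x,y]]=0$ and $\alpha_L([x,y])=[\alpha_L(x),\alpha_L(y)]$ for all $x,y,z\in L$. $[L,L]$ is the span of all $[x,y]$. $(L\star L,\alpha_\star)$ is the Hom-Lie algebra generated by symbols $l\star l'$ ($l,l'\in L$), bilinear in $l,l'$ over $\mathbb F$, subject to $[m,m']\star\alpha_L(n)=\alpha_L(m)\star[m',n]-\alpha_L(m')\star[m,n]$, $\ \alpha_L(m)\star[n,n']=[n',m]\star\alpha_L(n)-[n,m]\star\alpha_L(n')$, $\ [m\star n,m'\star n']=-[n,m]\star[m',n']$, for all $m,m',n,n'\in L$, with $\alpha_\star(m\star n)=\alpha_L(m)\star\alpha_L(n)$. Let $L\square L$ be the subspace spanned by all $x\star x$, $x\in L$ (it is a central ideal). Then $L\curlywedge L=(L\star L)/(L\square L)$, and $m\curlywedge n$ is the image of $m\star n$. The tensor centre is $Z^{\star}_{\alpha}(L)=\{x\in L\mid\alpha_L^k(x)\star l=0\text{ in }L\star L\text{ for all }l\in L,\ k\ge0\}$ and the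 exterior centre is $Z^{\curlywedge}_{\alpha}(L)=\{x\in L\mid\alpha_L^k(x)\curlywedge l=0\text{ in }L\curlywedge L\text{ for all }l\in L,\ k\ge0\}$.
   Formalization: Hom-Lie algebras, both L and the presented L⋆L, are also required to satisfy [x,x]=0; this follows from [x,y]=-[y,x] unless the characteristic is 2, where the claim with antisymmetry alone is false. *)

theory Defs
  imports Complex_Main
begin

text \<open>
  Antisymmetry \<open>[x,y] = -[y,x]\<close> is accompanied by \<open>[x,x] = 0\<close>. The latter follows from the
  former unless the field has characteristic 2 (lemma \<open>alternating_if_skew\<close> below); in
  characteristic 2 it is the usual convention for Lie-type brackets, and the equality of the
  tensor centre with the derived part of the exterior centre can fail without it.
\<close>

locale hom_lie_algebra = vector_space scale
  for scale :: "'f::field \<Rightarrow> 'a::ab_group_add \<Rightarrow> 'a" (infixr \<open>*s\<close> 75) +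
  fixes br :: "'a \<Rightarrow> 'a \<Rightarrow> 'a"
    and \<alpha> :: "'a \<Rightarrow> 'a"
  assumes linear_br_left: "Vector_Spaces.linear scale scale (\<lambda>x. br x y)"
    and linear_br_right: "Vector_Spaces.linear scale scale (\<lambda>y. br x y)"
    and linear_alpha: "Vector_Spaces.linear scale scale \<alpha>"
    and skew: "br x y = - br y x"
    and alternating: "br x x = 0"
    and hom_jacobi: "br (\<alpha> x) (br y z) + br (\<alpha> y) (br z x) + br (\<alpha> z) (br x y) = 0"
    and multiplicative: "\<alpha> (br x y) = br (\<alpha> x) (\<alpha> y)"

lemma alternating_if_skew:
  fixes scale :: "'f::field \<Rightarrow> 'a::ab_group_add \<Rightarrow> 'a"
  assumes "vector_space scale" and "(2::'f) \<noteq> 0" and skew: "\<And>x y. br x y = - br y x"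
  shows "br x x = (0::'a)"
proof -
  interpret vector_space scale by fact
  have "br x x + br x x = 0"
    using skew[of x x] by (metis add.right_inverse)
  moreover have "scale 2 (br x x) = br x x + br x x"
    using scale_left_distrib[of 1 1 "br x x"] by simp
  ultimately show ?thesis
    using assms(2) by simp
qed

text \<open>
  \<open>L \<star> L\<close> is given by generators and relations: formal expressions in the generators \<open>Gen m n\<close>
  and the operations of a Hom-Lie algebra over the field, modulo the least congruence that
  contains the Hom-Lie algebra axioms and the defining relations.
\<close>

datatype ('f, 'a) hl_term =
    Gen 'a 'a
  | Zero
  | Add "('f, 'a) hl_term" "('f, 'a) hl_term"
  | Scale 'f "('f, 'a) hl_term"
  | Br "('f, 'a) hl_term" "('f, 'a) hl_term"
  | Alpha "('f, 'a) hl_term"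

abbreviation Neg :: "('f::field, 'a) hl_term \<Rightarrow> ('f, 'a) hl_term"
  where "Neg t \<equiv> Scale (- 1) t"

abbreviation Sub :: "('f::field, 'a) hl_term \<Rightarrow> ('f, 'a) hl_term \<Rightarrow> ('f, 'a) hl_term"
  where "Sub t u \<equiv> Add t (Neg u)"

context hom_lie_algebra
begin

definition derived :: "'a set"
  where "derived = span {br x y | x y. True}"

inductive star_eq :: "('f, 'a) hl_term \<Rightarrow> ('f, 'a) hl_term \<Rightarrow> bool" (infix \<open>\<approx>\<close> 50)
  where
    refl: "t \<approx> t"
  | sym: "t \<approx> u \<Longrightarrow> u \<approx> t"
  | trans: "t \<approx> u \<Longrightarrow> u \<approx> v \<Longrightarrow> t \<approx> v"
  | cong_add: "t \<approx> t' \<Longrightarrow> u \<approx> u' \<Longrightarrow> Add t u \<approx> Add t' u'"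
  | cong_scale: "t \<approx> t' \<Longrightarrow> Scale a t \<approx> Scale a t'"
  | cong_br: "t \<approx> t' \<Longrightarrow> u \<approx> u' \<Longrightarrow> Br t u \<approx> Br t' u'"
  | cong_alpha: "t \<approx> t' \<Longrightarrow> Alpha t \<approx> Alpha t'"
    \<comment> \<open>vector space\<close>
  | add_assoc: "Add (Add t u) v \<approx> Add t (Add u v)"
  | add_commute: "Add t u \<approx> Add u t"
  | add_zero: "Add Zero t \<approx> t"
  | add_neg: "Sub t t \<approx> Zero"
  | scale_add_right: "Scale a (Add t u) \<approx> Add (Scale a t) (Scale a u)"
  | scale_add_left: "Scale (a + b) t \<approx> Add (Scale a t) (Scale b t)"
  | scale_scale: "Scale a (Scale b t) \<approx> Scale (a * b) t"
  | scale_one: "Scale 1 t \<approx> t"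
    \<comment> \<open>Hom-Lie algebra\<close>
  | br_add_left: "Br (Add t u) v \<approx> Add (Br t v) (Br u v)"
  | br_add_right: "Br t (Add u v) \<approx> Add (Br t u) (Br t v)"
  | br_scale_left: "Br (Scale a t) u \<approx> Scale a (Br t u)"
  | br_scale_right: "Br t (Scale a u) \<approx> Scale a (Br t u)"
  | alpha_add: "Alpha (Add t u) \<approx> Add (Alpha t) (Alpha u)"
  | alpha_scale: "Alpha (Scale a t) \<approx> Scale a (Alpha t)"
  | br_skew: "Br t u \<approx> Neg (Br u t)"
  | br_alternating: "Br t t \<approx> Zero"
  | br_jacobi: "Add (Add (Br (Alpha t) (Br u v)) (Br (Alpha u) (Br v t))) (Br (Alpha v) (Br t u)) \<approx> Zero"
  | alpha_br: "Alpha (Br t u) \<approx> Br (Alpha t) (Alpha u)"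
    \<comment> \<open>defining relations\<close>
  | gen_add_left: "Gen (m + m') n \<approx> Add (Gen m n) (Gen m' n)"
  | gen_add_right: "Gen m (n + n') \<approx> Add (Gen m n) (Gen m n')"
  | gen_scale_left: "Gen (a *s m) n \<approx> Scale a (Gen m n)"
  | gen_scale_right: "Gen m (a *s n) \<approx> Scale a (Gen m n)"
  | gen_br_left: "Gen (br m m') (\<alpha> n) \<approx> Sub (Gen (\<alpha> m) (br m' n)) (Gen (\<alpha> m') (br m n))"
  | gen_br_right: "Gen (\<alpha> m) (br n n') \<approx> Sub (Gen (br n' m) (\<alpha> n)) (Gen (br n m) (\<alpha> n'))"
  | br_gen: "Br (Gen m n) (Gen m' n') \<approx> Neg (Gen (br n m) (br m' n'))"
  | alpha_gen: "Alpha (Gen m n) \<approx> Gen (\<alpha> m) (\<alpha> n)"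

definition star_rel :: "(('f, 'a) hl_term \<times> ('f, 'a) hl_term) set"
  where "star_rel = {(t, u). t \<approx> u}"

definition star_square :: "('f, 'a) hl_term set set"
  where "star_square = UNIV // star_rel"

definition star :: "'a \<Rightarrow> 'a \<Rightarrow> ('f, 'a) hl_term set" (infix \<open>\<star>\<close> 70)
  where "m \<star> n = star_rel `` {Gen m n}"

definition star_zero :: "('f, 'a) hl_term set"
  where "star_zero = star_rel `` {Zero}"

lemma equiv_star_rel: "equiv UNIV star_rel"
  unfolding star_rel_def
  by (rule equivI) (auto simp: refl_on_def sym_def trans_def
      intro: star_eq.refl star_eq.sym star_eq.trans)

text \<open>
  The set of expressions representing elements of \<open>L \<box> L\<close>, the span of all \<open>x \<star> x\<close> in \<open>L \<star> L\<close>.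
\<close>

inductive_set box :: "('f, 'a) hl_term set"
  where
    box_gen: "Gen x x \<in> box"
  | box_zero: "Zero \<in> box"
  | box_add: "t \<in> box \<Longrightarrow> u \<in> box \<Longrightarrow> Add t u \<in> box"
  | box_scale: "t \<in> box \<Longrightarrow> Scale a t \<in> box"
  | box_eq: "t \<in> box \<Longrightarrow> t \<approx> u \<Longrightarrow> u \<in> box"

text \<open>
  Hence \<open>L \<curlywedge> L = (L \<star> L) / (L \<box> L)\<close> is the quotient of the expressions by the
  relation that their difference represents an element of \<open>L \<box> L\<close>.
\<close>

definition curly_rel :: "(('f, 'a) hl_term \<times> ('f, 'a) hl_term) set"
  where "curly_rel = {(t, u). Sub t u \<in> box}"

definition curly_square :: "('f, 'a) hl_term set set"
  where "curly_square = UNIV // curly_rel"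

definition curly :: "'a \<Rightarrow> 'a \<Rightarrow> ('f, 'a) hl_term set" (infix \<open>\<curlywedge>\<close> 70)
  where "m \<curlywedge> n = curly_rel `` {Gen m n}"

definition curly_zero :: "('f, 'a) hl_term set"
  where "curly_zero = curly_rel `` {Zero}"

lemma equiv_curly_rel: "equiv UNIV curly_rel"
proof (rule equivI)
  show "curly_rel \<subseteq> UNIV \<times> UNIV" by simp
  show "refl_on UNIV curly_rel"
    by (auto simp: refl_on_def curly_rel_def intro: box_eq[OF box_zero] star_eq.sym add_neg)
  show "sym curly_rel"
  proof (rule symI)
    fix t u assume "(t, u) \<in> curly_rel"
    then have "Neg (Sub t u) \<in> box"
      by (simp add: curly_rel_def box_scale)
    moreover have "Neg (Sub t u) \<approx> Add (Neg t) (Scale 1 u)"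
      using scale_add_right[of "- 1" t "Neg u"] scale_scale[of "- 1" "- 1" u]
      by (simp) (meson cong_add star_eq.refl star_eq.trans)
    moreover have "Add (Neg t) (Scale 1 u) \<approx> Sub u t"
      by (meson add_commute cong_add scale_one star_eq.refl star_eq.trans)
    ultimately show "(u, t) \<in> curly_rel"
      unfolding curly_rel_def by (auto intro: box_eq)
  qed
  show "trans curly_rel"
  proof (rule transI)
    fix t u v assume "(t, u) \<in> curly_rel" "(u, v) \<in> curly_rel"
    then have "Add (Sub t u) (Sub u v) \<in> box"
      by (simp add: curly_rel_def box_add)
    moreover have "Add (Sub t u) (Sub u v) \<approx> Add t (Add (Neg u) (Sub u v))"
      by (rule add_assoc)
    moreover have "Add (Neg u) (Sub u v) \<approx> Add (Add (Neg u) u) (Neg v)"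
      by (rule star_eq.sym[OF add_assoc])
    moreover have "Add (Neg u) u \<approx> Zero"
      by (rule star_eq.trans[OF add_commute add_neg])
    then have "Add (Add (Neg u) u) (Neg v) \<approx> Neg v"
      by (meson add_zero cong_add star_eq.refl star_eq.trans)
    ultimately have "Sub t v \<in> box"
      by (meson box_eq cong_add star_eq.refl star_eq.trans)
    then show "(t, v) \<in> curly_rel"
      by (simp add: curly_rel_def)
  qed
qed

definition tensor_centre :: "'a set"
  where "tensor_centre = {x. \<forall>l k. (\<alpha> ^^ k) x \<star> l = star_zero}"

definition exterior_centre :: "'a set"
  where "exterior_centre = {x. \<forall>l k. (\<alpha> ^^ k) x \<curlywedge> l = curly_zero}"

end

end

theory Submission
  imports Defs
begin

text \<open>
  The map \<open>m \<star> n \<mapsto> m \<otimes> n\<close> from \<open>L \<star> L\<close> to \<open>L/[L,L] \<otimes> L/[L,L]\<close> is well defined, and \<open>x \<otimes> x\<close>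
  is nonzero there unless \<open>x \<in> [L,L]\<close>; so the tensor centre lies in \<open>[L,L]\<close>. Conversely, if \<open>\<alpha>\<close>
  is surjective, the relations force \<open>c \<star> l = - l \<star> c\<close> and \<open>c \<star> c = 0\<close> for \<open>c \<in> [L,L]\<close>. Hence
  \<open>x \<star> x\<close> depends only on \<open>x\<close> modulo \<open>[L,L]\<close>, and the map above is injective on \<open>L \<box> L\<close>, where
  it has a left inverse induced by a complement of \<open>[L,L]\<close>. Since it sends \<open>c \<star> l\<close> to 0 for
  \<open>c \<in> [L,L]\<close>, such an element of \<open>L \<box> L\<close> vanishes.
\<close>

context hom_lie_algebra
begin

section \<open>Vector space arithmetic modulo \<open>\<approx>\<close>\<close>

declare star_eq.refl [simp, intro]
declare star_eq.trans [trans]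

lemma cong_add_left: "t \<approx> t' \<Longrightarrow> Add t u \<approx> Add t' u"
  and cong_add_right: "u \<approx> u' \<Longrightarrow> Add t u \<approx> Add t u'"
  by (auto intro: cong_add)

lemma add_zero_right: "Add t Zero \<approx> t"
  by (rule star_eq.trans[OF add_commute add_zero])

lemma neg_add: "Add (Neg t) t \<approx> Zero"
  by (rule star_eq.trans[OF add_commute add_neg])

lemma scale_zero_left: "Scale 0 t \<approx> Zero"
proof -
  have "Scale 0 t \<approx> Add (Scale 1 t) (Neg t)"
    using scale_add_left[of 1 "- 1" t] by simp
  also have "\<dots> \<approx> Sub t t"
    by (intro cong_add_left scale_one)
  also have "\<dots> \<approx> Zero"
    by (rule add_neg)
  finally show ?thesis .
qed

lemma scale_zero_right: "Scale a Zero \<approx> Zero"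
proof -
  have "Scale a Zero \<approx> Scale a (Scale 0 Zero)"
    by (intro cong_scale star_eq.sym[OF scale_zero_left])
  also have "\<dots> \<approx> Scale 0 Zero"
    using scale_scale[of a 0 Zero] by simp
  also have "\<dots> \<approx> Zero"
    by (rule scale_zero_left)
  finally show ?thesis .
qed

lemma neg_neg: "Neg (Neg t) \<approx> t"
  using scale_scale[of "- 1" "- 1" t] scale_one star_eq.trans by simp

lemma sub_zero: "Sub t Zero \<approx> t"
  by (rule star_eq.trans[OF cong_add_right[OF scale_zero_right] add_zero_right])

lemma add_left_cancel:
  assumes "Add t u \<approx> Add t v"
  shows "u \<approx> v"
proof -
  have *: "Add (Neg t) (Add t w) \<approx> w" for w
  proof -
    have "Add (Neg t) (Add t w) \<approx> Add (Add (Neg t) t) w"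
      by (rule star_eq.sym[OF add_assoc])
    also have "\<dots> \<approx> Add Zero w"
      by (intro cong_add_left neg_add)
    also have "\<dots> \<approx> w"
      by (rule add_zero)
    finally show ?thesis .
  qed
  show ?thesis
    using *[of u] *[of v] cong_add_right[OF assms, of "Neg t"]
    by (meson star_eq.sym star_eq.trans)
qed

lemma add_eq_zero_iff: "Add t u \<approx> Zero \<longleftrightarrow> t \<approx> Neg u"
proof
  assume "Add t u \<approx> Zero"
  then have "Add u t \<approx> Sub u u"
    by (meson add_commute add_neg star_eq.sym star_eq.trans)
  then show "t \<approx> Neg u"
    by (rule add_left_cancel)
next
  assume "t \<approx> Neg u"
  then show "Add t u \<approx> Zero"
    by (meson cong_add_left neg_add star_eq.trans)
qed

lemma scale_eq_zero: "t \<approx> Zero \<Longrightarrow> Scale a t \<approx> Zero"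
  by (meson cong_scale scale_zero_right star_eq.trans)

lemma add_eq_zero: "t \<approx> Zero \<Longrightarrow> u \<approx> Zero \<Longrightarrow> Add t u \<approx> Zero"
  by (meson cong_add add_zero star_eq.trans)

lemma add_add_commute: "Add (Add t u) (Add v w) \<approx> Add (Add t v) (Add u w)"
proof -
  have "Add (Add t u) (Add v w) \<approx> Add t (Add u (Add v w))"
    by (rule add_assoc)
  also have "\<dots> \<approx> Add t (Add (Add u v) w)"
    by (intro cong_add_right star_eq.sym[OF add_assoc])
  also have "\<dots> \<approx> Add t (Add (Add v u) w)"
    by (intro cong_add_right cong_add_left add_commute)
  also have "\<dots> \<approx> Add t (Add v (Add u w))"
    by (intro cong_add_right add_assoc)
  also have "\<dots> \<approx> Add (Add t v) (Add u w)"
    by (rule star_eq.sym[OF add_assoc])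
  finally show ?thesis .
qed

section \<open>Bilinearity and skew symmetry of generators\<close>

lemma gen_zero_left: "Gen 0 n \<approx> Zero"
  using gen_scale_left[of 0 0 n] scale_zero_left star_eq.trans by force

lemma gen_zero_right: "Gen m 0 \<approx> Zero"
  using gen_scale_right[of m 0 0] scale_zero_left star_eq.trans by force

lemma gen_uminus_left: "Gen (- m) n \<approx> Neg (Gen m n)"
  using gen_scale_left[of "- 1" m n] by simp

lemma gen_uminus_right: "Gen m (- n) \<approx> Neg (Gen m n)"
  using gen_scale_right[of m "- 1" n] by simp

text \<open>
  Expanding the first factor of the relation \<open>gen_br_left\<close> by \<open>gen_br_right\<close> reproduces the
  left-hand side; what remains is skew-symmetry, with no division by 2.
\<close>

lemma gen_br_alpha_skew: "Gen (br m n) (\<alpha> l) \<approx> Neg (Gen (\<alpha> l) (br m n))"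
proof -
  let ?A = "Gen (br n l) (\<alpha> m)" and ?X = "Gen (br m n) (\<alpha> l)" and ?Y = "Gen (\<alpha> l) (br n m)"
  have "Gen (br l n) (\<alpha> m) \<approx> Neg ?A"
    using gen_uminus_left[of "br n l" "\<alpha> m"] skew[of l n] by simp
  then have "Neg (Gen (br l n) (\<alpha> m)) \<approx> ?A"
    by (meson cong_scale neg_neg star_eq.trans)
  then have "Gen (\<alpha> n) (br l m) \<approx> Add ?X ?A"
    by (meson gen_br_right cong_add_right star_eq.trans)
  then have "?A \<approx> Sub (Add ?X ?A) ?Y"
    by (meson gen_br_left cong_add_left star_eq.trans)
  also have "\<dots> \<approx> Sub (Add ?A ?X) ?Y"
    by (intro cong_add_left add_commute)
  also have "\<dots> \<approx> Add ?A (Sub ?X ?Y)"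
    by (rule add_assoc)
  finally have "Add ?A (Sub ?X ?Y) \<approx> Add ?A Zero"
    by (meson add_zero_right star_eq.sym star_eq.trans)
  then have "?X \<approx> Neg (Neg ?Y)"
    by (simp add: add_left_cancel flip: add_eq_zero_iff)
  also have "\<dots> \<approx> ?Y"
    by (rule neg_neg)
  also have "\<dots> \<approx> Neg (Gen (\<alpha> l) (br m n))"
    using gen_uminus_right[of "\<alpha> l" "br m n"] skew[of n m] by simp
  finally show ?thesis .
qed

text \<open>By surjectivity every \<open>l\<close> has the form \<open>\<alpha> l'\<close>, so
  \<open>gen_br_alpha_skew\<close> settles brackets; both summands are linear in \<open>c\<close>,
  which carries the claim to their span.\<close>

lemma gen_derived_skew:
  assumes "surj \<alpha>" and "c \<in> derived"
  shows "Add (Gen c l) (Gen l c) \<approx> Zero"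
  using assms(2) unfolding derived_def
proof (induction rule: span_induct_alt)
  case base
  show ?case
    by (intro add_eq_zero gen_zero_left gen_zero_right)
next
  case (step a b c)
  then obtain m n where b: "b = br m n"
    by blast
  obtain l' where l: "l = \<alpha> l'"
    using assms(1) by (metis surjD)
  have b0: "Add (Gen b l) (Gen l b) \<approx> Zero"
    unfolding b l add_eq_zero_iff by (rule gen_br_alpha_skew)
  have "Gen (a *s b + c) l \<approx> Add (Scale a (Gen b l)) (Gen c l)"
    by (meson gen_add_left gen_scale_left cong_add_left star_eq.trans)
  moreover have "Gen l (a *s b + c) \<approx> Add (Scale a (Gen l b)) (Gen l c)"
    by (meson gen_add_right gen_scale_right cong_add_left star_eq.trans)
  ultimately have "Add (Gen (a *s b + c) l) (Gen l (a *s b + c))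
      \<approx> Add (Add (Scale a (Gen b l)) (Gen c l)) (Add (Scale a (Gen l b)) (Gen l c))"
    by (rule cong_add)
  also have "\<dots> \<approx> Add (Add (Scale a (Gen b l)) (Scale a (Gen l b))) (Add (Gen c l) (Gen l c))"
    by (rule add_add_commute)
  also have "\<dots> \<approx> Zero"
    by (meson add_eq_zero scale_eq_zero[OF b0] step.IH scale_add_right star_eq.sym star_eq.trans)
  finally show ?case .
qed

lemma gen_add_self:
  assumes "Add (Gen m n) (Gen n m) \<approx> Zero"
  shows "Gen (m + n) (m + n) \<approx> Add (Gen m m) (Gen n n)"
proof -
  have "Gen (m + n) (m + n) \<approx> Add (Gen m (m + n)) (Gen n (m + n))"
    by (rule gen_add_left)
  also have "\<dots> \<approx> Add (Add (Gen m m) (Gen m n)) (Add (Gen n n) (Gen n m))"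
    by (meson gen_add_right add_commute cong_add star_eq.trans)
  also have "\<dots> \<approx> Add (Add (Gen m m) (Gen n n)) (Add (Gen m n) (Gen n m))"
    by (rule add_add_commute)
  also have "\<dots> \<approx> Add (Add (Gen m m) (Gen n n)) Zero"
    by (intro cong_add_right assms)
  also have "\<dots> \<approx> Add (Gen m m) (Gen n n)"
    by (rule add_zero_right)
  finally show ?thesis .
qed

text \<open>Skew symmetry alone gives only 2(c \<star> c) = 0, which is empty in characteristic 2.
  It does make c \<star> c additive in c on [L,L], so brackets are enough, and there alternation in
  L \<star> L applies.\<close>

lemma gen_derived_alternating:
  assumes "surj \<alpha>" and "c \<in> derived"
  shows "Gen c c \<approx> Zero"
  using assms(2) unfolding derived_def
proof (induction rule: span_induct_alt)
  case base
  show ?case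
    by (rule gen_zero_left)
next
  case (step a b c)
  then obtain m n where b: "b = br m n"
    by blast
  have "b \<in> derived"
    using step.hyps(1) by (simp add: derived_def span_base)
  then have "a *s b \<in> derived"
    by (simp add: derived_def span_scale)
  then have *: "Gen (a *s b + c) (a *s b + c) \<approx> Add (Gen (a *s b) (a *s b)) (Gen c c)"
    by (intro gen_add_self gen_derived_skew assms(1))
  \<comment> \<open>As b = [m,n] = -[n,m], the element b \<star> b equals -([n,m] \<star> [m,n]),
    which \<open>br_gen\<close> identifies with the bracket of m \<star> n with itself.\<close>
  have "Gen b b \<approx> Neg (Neg (Gen b b))"
    by (rule star_eq.sym[OF neg_neg])
  also have "\<dots> \<approx> Neg (Gen (br n m) (br m n))"
    using gen_uminus_left[of b b] skew[of n m]
    unfolding b by (auto intro: cong_scale star_eq.sym)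
  also have "\<dots> \<approx> Br (Gen m n) (Gen m n)"
    by (rule star_eq.sym[OF br_gen])
  also have "\<dots> \<approx> Zero"
    by (rule br_alternating)
  finally have "Gen b b \<approx> Zero" .
  then have "Gen (a *s b) (a *s b) \<approx> Zero"
    by (meson gen_scale_left gen_scale_right scale_eq_zero star_eq.trans)
  then show ?case
    using * step.IH by (meson add_eq_zero star_eq.trans)
qed

section \<open>Powers of \<alpha>, and linear maps vanishing on [L,L]\<close>

lemma funpow_alpha_br: "(\<alpha> ^^ k) (br x y) = br ((\<alpha> ^^ k) x) ((\<alpha> ^^ k) y)"
  by (induction k) (simp_all add: multiplicative)

lemma funpow_alpha_add: "(\<alpha> ^^ k) (x + y) = (\<alpha> ^^ k) x + (\<alpha> ^^ k) y"
  and funpow_alpha_scale: "(\<alpha> ^^ k) (a *s x) = a *s (\<alpha> ^^ k) x"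
proof -
  interpret \<alpha>: Vector_Spaces.linear scale scale \<alpha>
    by (rule linear_alpha)
  show "(\<alpha> ^^ k) (x + y) = (\<alpha> ^^ k) x + (\<alpha> ^^ k) y" "(\<alpha> ^^ k) (a *s x) = a *s (\<alpha> ^^ k) x"
    by (induction k) (simp_all add: \<alpha>.add \<alpha>.scale)
qed

lemma br_in_derived: "br x y \<in> derived"
  unfolding derived_def by (auto intro: span_base)

lemma subspace_derived: "subspace derived"
  by (simp add: derived_def)

lemma funpow_alpha_derived:
  assumes "x \<in> derived"
  shows "(\<alpha> ^^ k) x \<in> derived"
  using assms[unfolded derived_def]
proof (induction rule: span_induct_alt)
  case base
  show ?case
    using funpow_alpha_scale[of k 0 0] subspace_0[OF subspace_derived] by simp
next
  case (step a b c)
  then have "(\<alpha> ^^ k) b \<in> derived"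
    by (auto simp: funpow_alpha_br br_in_derived)
  then show ?case
    unfolding funpow_alpha_add funpow_alpha_scale
    by (intro subspace_add subspace_scale subspace_derived step.IH)
qed

text \<open>A basis \<open>A\<close> of [L,L] extends to a basis of L; \<open>\<pi>\<close> kills
  \<open>A\<close> and fixes the added vectors, so b - \<pi> b is b or 0 on the basis and lies in
  [L,L].\<close>

lemma ex_projection_along_derived:
  obtains \<pi> where "Vector_Spaces.linear scale scale \<pi>"
    and "\<And>c. c \<in> derived \<Longrightarrow> \<pi> c = 0" and "\<And>x. x - \<pi> x \<in> derived"
proof -
  interpret vector_space_pair scale scale ..
  obtain A where A: "A \<subseteq> derived" "independent A" "derived \<subseteq> span A"
    using maximal_independent_subset by blast
  have ind: "independent (extend_basis A)" and spn: "span (extend_basis A) = UNIV"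
    using A independent_extend_basis span_extend_basis by auto
  obtain \<pi> where lin: "Vector_Spaces.linear scale scale \<pi>"
    and \<pi>: "\<And>b. b \<in> extend_basis A \<Longrightarrow> \<pi> b = (if b \<in> A then 0 else b)"
    using linear_independent_extend[OF ind, of "\<lambda>b. if b \<in> A then 0 else b"] by blast
  show thesis
  proof
    show "Vector_Spaces.linear scale scale \<pi>" by fact
    show "\<pi> c = 0" if "c \<in> derived" for c
    proof (rule linear_eq_0_on_span[OF lin])
      show "\<pi> b = 0" if "b \<in> A" for b
        using that extend_basis_superset[OF A(2)] by (auto simp: \<pi>)
      show "c \<in> span A"
        using A that by blast
    qed
    show "x - \<pi> x \<in> derived" for x
    proof -
      have "x \<in> span (extend_basis A)"
        using spn by simp
      then show ?thesis
      proof (induction rule: span_induct_alt)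
        case base
        show ?case
          by (simp add: linear_0[OF lin] subspace_0 subspace_derived)
      next
        case (step a b y)
        have "b - \<pi> b \<in> derived"
          using step.hyps A(1) by (auto simp: \<pi> subspace_0 subspace_derived)
        then have "a *s (b - \<pi> b) + (y - \<pi> y) \<in> derived"
          by (intro subspace_add subspace_scale subspace_derived step.IH)
        then show ?case
          by (simp add: linear_add[OF lin] linear_scale[OF lin] scale_right_diff_distrib algebra_simps)
      qed
    qed
  qed
qed

text \<open>Outside [L,L] the projection \<open>\<pi> x\<close> is nonzero, so some functional
  \<open>h\<close> takes the value 1 there; compose it with \<open>\<pi>\<close>.\<close>

lemma ex_functional_along_derived:
  assumes "x \<notin> derived"
  obtains f where "Vector_Spaces.linear scale (*) f"
    and "\<And>c. c \<in> derived \<Longrightarrow> f c = 0" and "f x = 1"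
proof -
  interpret to_field: vector_space_pair scale "(*) :: 'f \<Rightarrow> 'f \<Rightarrow> 'f"
    by unfold_locales (simp_all add: algebra_simps)
  obtain \<pi> where \<pi>: "Vector_Spaces.linear scale scale \<pi>"
    "\<And>c. c \<in> derived \<Longrightarrow> \<pi> c = 0" "\<And>x. x - \<pi> x \<in> derived"
    using ex_projection_along_derived by blast
  have "\<pi> x \<noteq> 0"
    using \<pi>(3)[of x] assms by auto
  then have "independent {\<pi> x}"
    by simp
  then obtain h where h: "Vector_Spaces.linear scale (*) h" "h (\<pi> x) = 1"
    using to_field.linear_independent_extend[of "{\<pi> x}" "\<lambda>_. 1"] by auto
  show thesis
  proof
    show "Vector_Spaces.linear scale (*) (h \<circ> \<pi>)"
      using Vector_Spaces.linear_compose \<pi>(1) h(1) by blast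
    show "(h \<circ> \<pi>) c = 0" if "c \<in> derived" for c
      using that \<pi>(2) to_field.linear_0[OF h(1)] by simp
    show "(h \<circ> \<pi>) x = 1"
      using h(2) by simp
  qed
qed

section \<open>Maps on L \<star> L that factor through L/[L,L] \<otimes> L/[L,L]\<close>

text \<open>
  Evaluation in the abelian Hom-Lie algebra of sequences with the shift as twisting map;
  the first argument is the position in the sequence.
\<close>

primrec form_eval :: "('a \<Rightarrow> 'f) \<Rightarrow> nat \<Rightarrow> ('f, 'a) hl_term \<Rightarrow> 'f"
  where
    "form_eval f k (Gen m n) = f ((\<alpha> ^^ k) m) * f ((\<alpha> ^^ k) n)"
  | "form_eval f k Zero = 0"
  | "form_eval f k (Add t u) = form_eval f k t + form_eval f k u"
  | "form_eval f k (Scale a t) = a * form_eval f k t"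
  | "form_eval f k (Br t u) = 0"
  | "form_eval f k (Alpha t) = form_eval f (Suc k) t"

text \<open>Powers of \<alpha> send brackets to brackets, where \<open>f\<close> vanishes, so both
  sides of every relation involving a bracket evaluate to 0. The position stays arbitrary in the
  induction because \<open>Alpha\<close> raises it.\<close>

lemma form_eval_eq:
  assumes f: "Vector_Spaces.linear scale (*) f" and f0: "\<And>c. c \<in> derived \<Longrightarrow> f c = 0"
    and "t \<approx> u"
  shows "form_eval f k t = form_eval f k u"
proof -
  have add: "f (x + y) = f x + f y" and scale: "f (a *s x) = a * f x" for x y a
    using f by (simp_all add: Vector_Spaces.linear_iff)
  show ?thesis
    using assms(3)
    by (induction arbitrary: k rule: star_eq.induct)
      (simp_all add: funpow_alpha_add funpow_alpha_scale funpow_alpha_br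
        add scale f0 br_in_derived algebra_simps funpow_swap1)
qed

lemma gen_self_imp_derived:
  assumes "Gen x x \<approx> Zero"
  shows "x \<in> derived"
proof (rule ccontr)
  assume "x \<notin> derived"
  then obtain f where f: "Vector_Spaces.linear scale (*) f" "\<And>c. c \<in> derived \<Longrightarrow> f c = 0" "f x = 1"
    using ex_functional_along_derived by blast
  \<comment> \<open>At position 0 the term \<open>Gen x x\<close> evaluates to f(x)^2 = 1, but
    \<open>Zero\<close> to 0.\<close>
  show False
    using form_eval_eq[OF f(1,2) assms, of 0] f(3) by simp
qed

text \<open>
  If \<open>\<pi>\<close> projects along \<open>[L,L]\<close>, then at position 0 this induces the linear endomorphism
  \<open>m \<star> n \<mapsto> \<pi> m \<star> \<pi> n\<close> of \<open>L \<star> L\<close>; it factors through \<open>L/[L,L] \<otimes> L/[L,L]\<close>.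
  The position counts the applications of \<open>Alpha\<close> still to be pushed to the generators.
\<close>

primrec proj_term :: "('a \<Rightarrow> 'a) \<Rightarrow> nat \<Rightarrow> ('f, 'a) hl_term \<Rightarrow> ('f, 'a) hl_term"
  where
    "proj_term \<pi> k (Gen m n) = Gen (\<pi> ((\<alpha> ^^ k) m)) (\<pi> ((\<alpha> ^^ k) n))"
  | "proj_term \<pi> k Zero = Zero"
  | "proj_term \<pi> k (Add t u) = Add (proj_term \<pi> k t) (proj_term \<pi> k u)"
  | "proj_term \<pi> k (Scale a t) = Scale a (proj_term \<pi> k t)"
  | "proj_term \<pi> k (Br t u) = Zero"
  | "proj_term \<pi> k (Alpha t) = proj_term \<pi> (Suc k) t"

text \<open>Linear relations go to instances of themselves; in those with brackets both sides become
  equal to \<open>Zero\<close>, since \<open>\<pi>\<close> kills [L,L].\<close>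

lemma proj_term_cong:
  assumes \<pi>: "Vector_Spaces.linear scale scale \<pi>" and \<pi>0: "\<And>c. c \<in> derived \<Longrightarrow> \<pi> c = 0"
    and "t \<approx> u"
  shows "proj_term \<pi> k t \<approx> proj_term \<pi> k u"
proof -
  interpret \<pi>: Vector_Spaces.linear scale scale \<pi>
    by (rule \<pi>)
  have eq_if_zero: "t \<approx> u" if "t \<approx> Zero" "u \<approx> Zero" for t u
    using that star_eq.sym star_eq.trans by blast
  note zeros = gen_zero_left gen_zero_right add_eq_zero scale_eq_zero star_eq.refl
  show ?thesis
    using assms(3)
  proof (induction arbitrary: k rule: star_eq.induct)
    case (sym t u)
    then show ?case by (blast intro: star_eq.sym)
  next
    case (trans t u v)
    then show ?case by (blast intro: star_eq.trans)
  next
    case (gen_br_left m m' n)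
    show ?case
      by (simp add: funpow_alpha_br \<pi>0 br_in_derived del: funpow.simps) (rule eq_if_zero; intro zeros)
  next
    case (gen_br_right m n n')
    show ?case
      by (simp add: funpow_alpha_br \<pi>0 br_in_derived del: funpow.simps) (rule eq_if_zero; intro zeros)
  next
    case (br_gen m n m' n')
    show ?case
      by (simp add: funpow_alpha_br \<pi>0 br_in_derived del: funpow.simps) (rule eq_if_zero; intro zeros)
  next
    case (alpha_gen m n)
    show ?case
      by (simp add: funpow_swap1)
  next
    case (br_skew t u)
    show ?case
      by simp (rule eq_if_zero; intro zeros)
  next
    case (cong_add t t' u u')
    then show ?case
      by (simp add: star_eq.cong_add)
  next
    case (cong_scale t t' a)
    then show ?case
      by (simp add: star_eq.cong_scale)
  qed (simp_all del: funpow.simps add: funpow_alpha_add funpow_alpha_scale \<pi>.add \<pi>.scale,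
      (rule star_eq.add_assoc star_eq.add_commute star_eq.add_zero star_eq.add_neg
          star_eq.scale_add_right star_eq.scale_add_left star_eq.scale_scale star_eq.scale_one
          star_eq.gen_add_left star_eq.gen_add_right star_eq.gen_scale_left star_eq.gen_scale_right
        | rule eq_if_zero; intro zeros)+)
qed

text \<open>In x = (x - \<pi> x) + \<pi> x the summand from [L,L] contributes neither cross terms
  nor a square, so x \<star> x = \<pi> x \<star> \<pi> x.\<close>

lemma proj_term_box:
  assumes "surj \<alpha>"
    and \<pi>: "Vector_Spaces.linear scale scale \<pi>" "\<And>c. c \<in> derived \<Longrightarrow> \<pi> c = 0"
      "\<And>x. x - \<pi> x \<in> derived"
    and "t \<in> box"
  shows "proj_term \<pi> 0 t \<approx> t"
  using assms(5)
proof induction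
  case (box_gen x)
  have "Gen x x \<approx> Gen ((x - \<pi> x) + \<pi> x) ((x - \<pi> x) + \<pi> x)"
    by simp
  also have "\<dots> \<approx> Add (Gen (x - \<pi> x) (x - \<pi> x)) (Gen (\<pi> x) (\<pi> x))"
    by (intro gen_add_self gen_derived_skew assms(1) \<pi>(3))
  also have "\<dots> \<approx> Add Zero (Gen (\<pi> x) (\<pi> x))"
    by (intro cong_add_left gen_derived_alternating assms(1) \<pi>(3))
  also have "\<dots> \<approx> Gen (\<pi> x) (\<pi> x)"
    by (rule add_zero)
  finally show ?case
    by (simp add: star_eq.sym)
next
  case (box_eq t u)
  then show ?case
    by (meson proj_term_cong[OF \<pi>(1,2)] star_eq.sym star_eq.trans)
qed (auto intro: cong_add cong_scale)

text \<open>The endomorphism induced by \<open>\<pi>\<close> fixes y \<star> l, an element of L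
  \<box> L, yet sends it to 0 \<star> \<pi> l.\<close>

lemma box_gen_derived_zero:
  assumes "surj \<alpha>" and "y \<in> derived" and "Gen y l \<in> box"
  shows "Gen y l \<approx> Zero"
proof -
  obtain \<pi> where \<pi>: "Vector_Spaces.linear scale scale \<pi>"
    "\<And>c. c \<in> derived \<Longrightarrow> \<pi> c = 0" "\<And>x. x - \<pi> x \<in> derived"
    using ex_projection_along_derived by blast
  have "Gen y l \<approx> Gen 0 (\<pi> l)"
    using proj_term_box[OF assms(1) \<pi> assms(3)] \<pi>(2)[OF assms(2)] by (simp add: star_eq.sym)
  also have "\<dots> \<approx> Zero"
    by (rule gen_zero_left)
  finally show ?thesis .
qed

section \<open>Comparison of the two centres\<close>

lemma star_eq_zero_iff: "m \<star> n = star_zero \<longleftrightarrow> Gen m n \<approx> Zero"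
  using eq_equiv_class_iff[OF equiv_star_rel, of "Gen m n" Zero]
  unfolding star_def star_zero_def by (auto simp: star_rel_def)

lemma curly_eq_zero_iff: "m \<curlywedge> n = curly_zero \<longleftrightarrow> Gen m n \<in> box"
proof -
  have "m \<curlywedge> n = curly_zero \<longleftrightarrow> Sub (Gen m n) Zero \<in> box"
    using eq_equiv_class_iff[OF equiv_curly_rel, of "Gen m n" Zero]
    unfolding curly_def curly_zero_def by (auto simp: curly_rel_def)
  also have "\<dots> \<longleftrightarrow> Gen m n \<in> box"
    using box_eq sub_zero star_eq.sym by blast
  finally show ?thesis .
qed

lemma tensor_centre_eq:
  assumes "surj \<alpha>"
  shows "tensor_centre = exterior_centre \<inter> derived"
proof (intro equalityI subsetI)
  fix x
  assume "x \<in> tensor_centre"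
  then have *: "Gen ((\<alpha> ^^ k) x) l \<approx> Zero" for k l
    by (simp add: tensor_centre_def star_eq_zero_iff)
  then have "x \<in> exterior_centre"
    by (auto simp: exterior_centre_def curly_eq_zero_iff intro: box_eq[OF box_zero] star_eq.sym)
  moreover have "x \<in> derived"
    \<comment> \<open>The case k = 0 and l = x gives x \<star> x = 0.\<close>
    using *[of 0 x] by (intro gen_self_imp_derived) simp
  ultimately show "x \<in> exterior_centre \<inter> derived"
    by simp
next
  fix x
  assume "x \<in> exterior_centre \<inter> derived"
  \<comment> \<open>[L,L] is stable under \<alpha>, so \<open>box_gen_derived_zero\<close> applies
    to every \<open>(\<alpha> ^^ k) x\<close>.\<close>
  then show "x \<in> tensor_centre"
    by (auto simp: exterior_centre_def tensor_centre_def curly_eq_zero_iff star_eq_zero_iff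
        intro: box_gen_derived_zero[OF assms] funpow_alpha_derived)
qed

end

theorem corollary5p4:
  fixes scale :: "'f::field \<Rightarrow> 'a::ab_group_add \<Rightarrow> 'a"
    and br :: "'a \<Rightarrow> 'a \<Rightarrow> 'a"
    and \<alpha> :: "'a \<Rightarrow> 'a"
  assumes "hom_lie_algebra scale br \<alpha>"
    and "surj \<alpha>"
  shows "hom_lie_algebra.tensor_centre scale br \<alpha> =
    hom_lie_algebra.exterior_centre scale br \<alpha> \<inter> hom_lie_algebra.derived scale br"
  by (rule hom_lie_algebra.tensor_centre_eq[OF assms])

end
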